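(* Let $k$ be a field, let $X$ be a well-ordered set, let $L(X)$ be the free $L$-algebra on $X$ with $k$-basis $N$ the set of normal $L$-words, and let $N$ carry the ordering $>$ given in the context. For $x,y,z,v\in N$ define elements of $L(X)$ by $$f_1(x,y,z)=(x\prec y)\prec z-x\prec(y\prec z)-x\prec(y\succ z),$$ $$f_2(x,y,z)=(x\prec y)\succ z+(x\succ y)\succ z-x\succ(y\succ z),$$ $$f_3(x,y,z,v)=((x\succ y)\succ z)\succ v-(x\succ y)\succ(z\succ v)+(x\succ(y\prec z))\succ v.$$ Then $S=\{f_1(x,y,z),\ f_2(x,y,z),\ f_3(x,y,z,v)\mid x,y,z,v\in N\}$ is a Gröbner-Shirshov basis in $L(X)$.
   Context: An $L$-algebra over a field $k$ is a $k$-vector space with two bilinear operations $\prec,\succ$ satisfying $(x\succ y)\prec z=x\succ(y\prec z)$ for all $x,y,z$. $L$-words over $X$ are the formal expressions built from elements of $X$ by the two binary operations $\prec,\succ$. An $L$-word $u$ is a normal $L$-word if it has one of the following forms: (i) $u=x$ with $x\in X$; (ii) $u=v\succ w$ with $v,w$ normal $L$-words; (iii) $u=v\prec w$ with $v,w$ normal $L$-words and $v$ not of the form $v_1\succ v_2$ with $v_1,v_2$ normal $L$-words. $N$ denotes the set of normal $L$-words. The free $L$-algebra $L(X)$ is the $k$-vector space with basis $N$ and bilinear operations determined for $u,v\in N$ by $u\succ v=[u\succ v]$, $u\prec v=[u\prec v]$, where $[u\succ v]$ is the word $u\succ v$; $[u\prec v]$ is the word $u\prec v$ if $u\in X$ or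 $u=u_1\prec u_2$; and $[u\prec v]=u_1\succ[u_2\prec v]$ if $u=u_1\succ u_2$. Ordering on $N$: write $\delta_1$ for $\succ$ and $\delta_2$ for $\prec$, with $\delta_2>\delta_1$; let $|u|$ be the number of occurrences of elements of $X$ in $u$. Put $wt(u)=(1,x)$ if $u=x\in X$, and $wt(u)=(|u|,\delta_i,u_1,u_2)$ if $u=\delta_i(u_1,u_2)\in N$ (that is, $u=u_1\succ u_2$ for $i=1$, $u=u_1\prec u_2$ for $i=2$). Then $u>v$ iff $wt(u)>wt(v)$ lexicographically, defined by induction on $|u|+|v|$. For nonzero $f\in L(X)$, $\bar f$ denotes the largest normal $L$-word occurring in $f$ (with nonzero coefficient); $f$ is monic if the coefficient of $\bar f$ is $1$. A $\star$-$L$-word is an $L$-word over $X\cup\{\star\}$ ($\star\notin X$) with exactly one occurrence of $\star$. For a $\star$-$L$-word $u$ and $s\in L(X)$, $u|_s$ is the element obtained by replacing $\star$ by $s$; it is called an $s$-word, and a normal $s$-word if $u|_{\bar s}\in N$ (that is, the word obtained by replacing $\star$ by the word $\bar s$ is a normal $L$-word). Compositions, for monic $f,g\in L(X)$: (1) Right multiplication: if $\bar f=u_1\succ u_2$ for some $u_1,u_2\in N$, then for every $v\in N$, $f\prec v$ is a composition of right multiplication. (2) Inclusion: if $w=\bar f=u|_{\bar g}$ where $u|_g$ is a normal $g$-word, then $(f,g)_w=f-u|_g$ is the composition of inclusion with ambiguity $w$. Triviality, for a monic set $S\subset L(X)$ and $f,g\in S$: $f\prec v$ is trivial modulo $S$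 if $f\prec v=\sum\alpha_i u_i|_{s_i}$ (finite sum) with $\alpha_i\in k$, $s_i\in S$, each $u_i|_{s_i}$ a normal $s_i$-word, and $u_i|_{\overline{s_i}}\le\overline{f\prec v}$. $(f,g)_w$ is trivial modulo $(S,w)$ if $(f,g)_w=\sum\alpha_i u_i|_{s_i}$ (finite sum) with $\alpha_i\in k$, $s_i\in S$, each $u_i|_{s_i}$ a normal $s_i$-word, and $u_i|_{\overline{s_i}}<w$. $S$ is a Gröbner-Shirshov basis in $L(X)$ if all compositions (of right multiplication and of inclusion) of elements of $S$ are trivial modulo $S$ (respectively modulo $(S,w)$). *)

theory Defs
  imports Complex_Main "HOL-Library.Poly_Mapping"
begin

datatype 'x lword = Gen 'x | WSucc "'x lword" "'x lword" | WPrec "'x lword" "'x lword"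

text \<open>In the last clause it is enough to exclude a left factor of the shape \<open>v\<^sub>1 \<succ> v\<^sub>2\<close>: since the
  left factor is itself normal, \<open>v\<^sub>1\<close> and \<open>v\<^sub>2\<close> are then normal automatically.\<close>

primrec normal :: "'x lword \<Rightarrow> bool" where
  "normal (Gen x) \<longleftrightarrow> True"
| "normal (WSucc v w) \<longleftrightarrow> normal v \<and> normal w"
| "normal (WPrec v w) \<longleftrightarrow> normal v \<and> normal w \<and> (\<nexists>v1 v2. v = WSucc v1 v2)"

definition normal_words :: "'x lword set" where
  "normal_words = {u. normal u}"

primrec len :: "'x lword \<Rightarrow> nat" where
  "len (Gen x) = 1"
| "len (WSucc u v) = len u + len v"
| "len (WPrec u v) = len u + len v"

lemma len_pos [simp]: "len u > 0"
  by (induction u) auto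

lemma len_add_gt_1 [simp]: "Suc 0 < len u + len v"
  using len_pos[of u] len_pos[of v] by linarith


text \<open>The ordering is the lexicographic comparison of the weights \<open>(1, x)\<close> and
  \<open>(|u|, \<delta>\<^sub>i, u\<^sub>1, u\<^sub>2)\<close>, where \<open>\<delta>\<^sub>1 = \<succ>\<close> is smaller than \<open>\<delta>\<^sub>2 = \<prec>\<close>. It is defined on all
  words, so that they form a linear order in the sense of the type class; only its restriction to
  normal words matters. In the last clause exactly one of the two words is a generator, and
  then the lengths differ.\<close>

instantiation lword :: (linorder) linorder
begin

fun less_lword :: "'a lword \<Rightarrow> 'a lword \<Rightarrow> bool" where
  "less_lword (Gen x) (Gen y) \<longleftrightarrow> x < y"
| "less_lword (WSucc u1 u2) (WSucc v1 v2) \<longleftrightarrow>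
     len (WSucc u1 u2) < len (WSucc v1 v2) \<or>
     len (WSucc u1 u2) = len (WSucc v1 v2) \<and>
       (less_lword u1 v1 \<or> u1 = v1 \<and> less_lword u2 v2)"
| "less_lword (WPrec u1 u2) (WPrec v1 v2) \<longleftrightarrow>
     len (WPrec u1 u2) < len (WPrec v1 v2) \<or>
     len (WPrec u1 u2) = len (WPrec v1 v2) \<and>
       (less_lword u1 v1 \<or> u1 = v1 \<and> less_lword u2 v2)"
| "less_lword (WSucc u1 u2) (WPrec v1 v2) \<longleftrightarrow> len (WSucc u1 u2) \<le> len (WPrec v1 v2)"
| "less_lword (WPrec u1 u2) (WSucc v1 v2) \<longleftrightarrow> len (WPrec u1 u2) < len (WSucc v1 v2)"
| "less_lword u v \<longleftrightarrow> len u < len v"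

definition less_eq_lword :: "'a lword \<Rightarrow> 'a lword \<Rightarrow> bool" where
  "less_eq_lword u v \<longleftrightarrow> u < v \<or> u = v"

lemma less_lword_len: "u < v \<Longrightarrow> len u \<le> len v" for u v :: "'a lword"
  by (induction u v rule: less_lword.induct) (auto simp: Suc_leI)

lemma less_lword_irrefl: "\<not> u < u" for u :: "'a lword"
  by (induction u) auto

lemma less_lword_total: "u < v \<or> u = v \<or> v < u" for u v :: "'a lword"
  by (induction u v rule: less_lword.induct) (auto simp: neq_iff)

lemma less_lword_trans: "u < v \<Longrightarrow> v < w \<Longrightarrow> u < w" for u v w :: "'a lword"
proof (induction u arbitrary: v w)
  case (Gen x)
  then show ?case
    using less_lword_len[OF Gen(1)] less_lword_len[OF Gen(2)]
    by (cases v; cases w) (auto simp: add_pos_pos less_Suc_eq Suc_lessI dest: less_le_trans)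
next
  case (WSucc u1 u2)
  then show ?case
    using less_lword_len[OF WSucc.prems(1)] less_lword_len[OF WSucc.prems(2)]
    by (cases v; cases w) auto
next
  case (WPrec u1 u2)
  then show ?case
    using less_lword_len[OF WPrec.prems(1)] less_lword_len[OF WPrec.prems(2)]
    by (cases v; cases w) auto
qed

instance
proof
  fix u v w :: "'a lword"
  show "u < v \<longleftrightarrow> u \<le> v \<and> \<not> v \<le> u"
    unfolding less_eq_lword_def by (metis less_lword_irrefl less_lword_trans)
  show "u \<le> u"
    by (simp add: less_eq_lword_def)
  show "u \<le> v \<Longrightarrow> v \<le> w \<Longrightarrow> u \<le> w"
    using less_lword_trans unfolding less_eq_lword_def by blast
  show "u \<le> v \<Longrightarrow> v \<le> u \<Longrightarrow> u = v"
    unfolding less_eq_lword_def by (metis less_lword_irrefl less_lword_trans)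
  show "u \<le> v \<or> v \<le> u"
    using less_lword_total unfolding less_eq_lword_def by blast
qed

end


text \<open>Linear combinations of words are finitely supported coefficient functions; the free
  \<open>L\<close>-algebra consists of those supported on normal words.\<close>

definition free_L :: "('x lword \<Rightarrow>\<^sub>0 'k::field) set" where
  "free_L = {f. Poly_Mapping.keys f \<subseteq> normal_words}"

definition base :: "'x lword \<Rightarrow> ('x lword \<Rightarrow>\<^sub>0 'k::field)" where
  "base u = Poly_Mapping.single u 1"

definition scale :: "'k::field \<Rightarrow> ('x lword \<Rightarrow>\<^sub>0 'k) \<Rightarrow> ('x lword \<Rightarrow>\<^sub>0 'k)" where
  "scale c f = Poly_Mapping.map ((*) c) f"

text \<open>The bracket \<open>[u \<prec> v]\<close>; the bracket \<open>[u \<succ> v]\<close> is just the word \<open>u \<succ> v\<close>.\<close>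

fun bracket_prec :: "'x lword \<Rightarrow> 'x lword \<Rightarrow> 'x lword" where
  "bracket_prec (WSucc u1 u2) v = WSucc u1 (bracket_prec u2 v)"
| "bracket_prec u v = WPrec u v"

definition bilinear_ext ::
  "('x lword \<Rightarrow> 'x lword \<Rightarrow> 'x lword) \<Rightarrow>
   ('x lword \<Rightarrow>\<^sub>0 'k::field) \<Rightarrow> ('x lword \<Rightarrow>\<^sub>0 'k) \<Rightarrow> ('x lword \<Rightarrow>\<^sub>0 'k)" where
  "bilinear_ext b f g =
     (\<Sum>u\<in>Poly_Mapping.keys f. \<Sum>v\<in>Poly_Mapping.keys g.
        Poly_Mapping.single (b u v) (Poly_Mapping.lookup f u * Poly_Mapping.lookup g v))"

definition lsucc :: "('x lword \<Rightarrow>\<^sub>0 'k::field) \<Rightarrow> ('x lword \<Rightarrow>\<^sub>0 'k) \<Rightarrow> ('x lword \<Rightarrow>\<^sub>0 'k)"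
    (infixl "\<succ>" 70) where
  "f \<succ> g = bilinear_ext WSucc f g"

definition lprec :: "('x lword \<Rightarrow>\<^sub>0 'k::field) \<Rightarrow> ('x lword \<Rightarrow>\<^sub>0 'k) \<Rightarrow> ('x lword \<Rightarrow>\<^sub>0 'k)"
    (infixl "\<prec>" 70) where
  "f \<prec> g = bilinear_ext bracket_prec f g"


text \<open>The leading word is only meaningful for nonzero elements.\<close>

definition lead :: "('x::linorder lword \<Rightarrow>\<^sub>0 'k::field) \<Rightarrow> 'x lword" where
  "lead f = Max (Poly_Mapping.keys f)"

definition monic :: "('x::linorder lword \<Rightarrow>\<^sub>0 'k::field) \<Rightarrow> bool" where
  "monic f \<longleftrightarrow> f \<noteq> 0 \<and> Poly_Mapping.lookup f (lead f) = 1"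

text \<open>Words over \<open>X \<union> {\<star>}\<close> are words over \<^typ>\<open>'x option\<close>, with \<^term>\<open>None\<close> for \<open>\<star>\<close>.\<close>

primrec star_count :: "'x option lword \<Rightarrow> nat" where
  "star_count (Gen a) = (if a = None then 1 else 0)"
| "star_count (WSucc u v) = star_count u + star_count v"
| "star_count (WPrec u v) = star_count u + star_count v"

definition star_word :: "'x option lword \<Rightarrow> bool" where
  "star_word u \<longleftrightarrow> star_count u = 1"

primrec subst_word :: "'x option lword \<Rightarrow> 'x lword \<Rightarrow> 'x lword" where
  "subst_word (Gen a) t = (case a of None \<Rightarrow> t | Some x \<Rightarrow> Gen x)"
| "subst_word (WSucc u v) t = WSucc (subst_word u t) (subst_word v t)"
| "subst_word (WPrec u v) t = WPrec (subst_word u t) (subst_word v t)"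

text \<open>The element \<open>u|\<^sub>s\<close>, computed with the operations of the free \<open>L\<close>-algebra.\<close>

primrec subst_elt :: "'x option lword \<Rightarrow> ('x lword \<Rightarrow>\<^sub>0 'k::field) \<Rightarrow> ('x lword \<Rightarrow>\<^sub>0 'k)" where
  "subst_elt (Gen a) s = (case a of None \<Rightarrow> s | Some x \<Rightarrow> base (Gen x))"
| "subst_elt (WSucc u v) s = subst_elt u s \<succ> subst_elt v s"
| "subst_elt (WPrec u v) s = subst_elt u s \<prec> subst_elt v s"

definition normal_s_word :: "'x option lword \<Rightarrow> ('x::linorder lword \<Rightarrow>\<^sub>0 'k::field) \<Rightarrow> bool" where
  "normal_s_word u s \<longleftrightarrow> star_word u \<and> subst_word u (lead s) \<in> normal_words"

text \<open>\<open>h\<close> is a linear combination of normal \<open>s\<close>-words, \<open>s \<in> S\<close>, whose words \<open>u|\<^bsub>lead s\<^esub>\<close> satisfy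
  the bound \<open>P\<close>.\<close>

definition combination_bounded ::
  "('x::linorder lword \<Rightarrow>\<^sub>0 'k::field) set \<Rightarrow> ('x lword \<Rightarrow> bool) \<Rightarrow> ('x lword \<Rightarrow>\<^sub>0 'k) \<Rightarrow> bool" where
  "combination_bounded S P h \<longleftrightarrow>
     (\<exists>(n::nat) (\<alpha> :: nat \<Rightarrow> 'k) (u :: nat \<Rightarrow> 'x option lword) (s :: nat \<Rightarrow> 'x lword \<Rightarrow>\<^sub>0 'k).
        (\<forall>i<n. s i \<in> S \<and> normal_s_word (u i) (s i) \<and> P (subst_word (u i) (lead (s i)))) \<and>
        h = (\<Sum>i<n. scale (\<alpha> i) (subst_elt (u i) (s i))))"

definition trivial_right_mult ::
  "('x::linorder lword \<Rightarrow>\<^sub>0 'k::field) set \<Rightarrow> ('x lword \<Rightarrow>\<^sub>0 'k) \<Rightarrow> 'x lword \<Rightarrow> bool" where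
  "trivial_right_mult S f v \<longleftrightarrow>
     combination_bounded S (\<lambda>t. t \<le> lead (f \<prec> base v)) (f \<prec> base v)"

definition trivial_inclusion ::
  "('x::linorder lword \<Rightarrow>\<^sub>0 'k::field) set \<Rightarrow> 'x lword \<Rightarrow> ('x lword \<Rightarrow>\<^sub>0 'k) \<Rightarrow> bool" where
  "trivial_inclusion S w h \<longleftrightarrow> combination_bounded S (\<lambda>t. t < w) h"

definition groebner_shirshov_basis :: "('x::linorder lword \<Rightarrow>\<^sub>0 'k::field) set \<Rightarrow> bool" where
  "groebner_shirshov_basis S \<longleftrightarrow>
     S \<subseteq> free_L \<and> (\<forall>f\<in>S. monic f) \<and>
     (\<forall>f\<in>S. \<forall>u1\<in>normal_words. \<forall>u2\<in>normal_words. lead f = WSucc u1 u2 \<longrightarrow>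
        (\<forall>v\<in>normal_words. trivial_right_mult S f v)) \<and>
     (\<forall>f\<in>S. \<forall>g\<in>S. \<forall>u w. w = lead f \<and> w = subst_word u (lead g) \<and> normal_s_word u g \<longrightarrow>
        trivial_inclusion S w (f - subst_elt u g))"


definition f1 :: "'x lword \<Rightarrow> 'x lword \<Rightarrow> 'x lword \<Rightarrow> ('x lword \<Rightarrow>\<^sub>0 'k::field)" where
  "f1 x y z = (base x \<prec> base y) \<prec> base z - base x \<prec> (base y \<prec> base z)
     - base x \<prec> (base y \<succ> base z)"

definition f2 :: "'x lword \<Rightarrow> 'x lword \<Rightarrow> 'x lword \<Rightarrow> ('x lword \<Rightarrow>\<^sub>0 'k::field)" where
  "f2 x y z = (base x \<prec> base y) \<succ> base z + (base x \<succ> base y) \<succ> base z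
     - base x \<succ> (base y \<succ> base z)"

definition f3 :: "'x lword \<Rightarrow> 'x lword \<Rightarrow> 'x lword \<Rightarrow> 'x lword \<Rightarrow> ('x lword \<Rightarrow>\<^sub>0 'k::field)" where
  "f3 x y z v = ((base x \<succ> base y) \<succ> base z) \<succ> base v
     - (base x \<succ> base y) \<succ> (base z \<succ> base v)
     + (base x \<succ> (base y \<prec> base z)) \<succ> base v"

end

theory Submission
  imports Defs
begin

text \<open>In an \<open>L\<close>-algebra the relations \<open>f\<^sub>1\<close> and \<open>f\<^sub>2\<close> are the remaining two dendriform axioms, and
  \<open>f\<^sub>3(x, y, z, v) = f\<^sub>2(x \<succ> y, z, v)\<close>. The normal words that contain none of the leading words are
  generated by \<open>x\<close>, \<open>x \<prec> b\<close>, \<open>x \<succ> b\<close> and \<open>(x \<succ> c) \<succ> b\<close> with \<open>x \<in> X\<close>. Their span \<open>D\<close> carries a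
  dendriform structure, so there is a homomorphism \<open>nf\<close> from \<open>L(X)\<close> to \<open>D\<close> that kills the relations.
  Rewriting a reducible word \<open>u|\<^bsub>lead s\<^esub>\<close> with \<open>u|\<^sub>s\<close> terminates and preserves \<open>nf\<close>, so each \<open>h\<close> differs
  from \<open>nf h\<close> by a combination of normal \<open>s\<close>-words bounded by the words of \<open>h\<close>. All compositions lie in the
  kernel of \<open>nf\<close>, hence they are trivial, and no composition has to be computed.\<close>

section \<open>Linear extension\<close>

text \<open>The formula of \<open>scale\<close> over an arbitrary basis: normal forms are
  combinations of trees, to which \<open>scale\<close> does not apply.\<close>

definition smul :: "'k::field \<Rightarrow> ('a \<Rightarrow>\<^sub>0 'k) \<Rightarrow> ('a \<Rightarrow>\<^sub>0 'k)" where
  "smul c p = Poly_Mapping.map ((*) c) p"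

lemma lookup_smul [simp]: "Poly_Mapping.lookup (smul c p) a = c * Poly_Mapping.lookup p a"
  by (simp add: smul_def map.rep_eq when_def)

lemma scale_eq_smul: "scale c f = smul c f"
  by (simp add: scale_def smul_def)

lemma smul_add: "smul c (p + q) = smul c p + smul c q"
  by (rule poly_mapping_eqI) (simp add: lookup_add algebra_simps)

lemma smul_diff: "smul c (p - q) = smul c p - smul c q"
  by (rule poly_mapping_eqI) (simp add: lookup_minus algebra_simps)

lemma smul_add_left: "smul (c + d) p = smul c p + smul d p"
  by (rule poly_mapping_eqI) (simp add: lookup_add algebra_simps)

lemma smul_smul: "smul c (smul d p) = smul (c * d) p"
  by (rule poly_mapping_eqI) simp

lemma smul_zero_left [simp]: "smul 0 p = 0"
  by (rule poly_mapping_eqI) simp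

lemma smul_zero_right [simp]: "smul c 0 = 0"
  by (rule poly_mapping_eqI) simp

lemma smul_one [simp]: "smul 1 p = p"
  by (rule poly_mapping_eqI) simp

lemma smul_minus_one: "smul (- 1) p = - p"
  by (rule poly_mapping_eqI) simp

lemma smul_single: "smul c (Poly_Mapping.single a d) = Poly_Mapping.single a (c * d)"
  by (rule poly_mapping_eqI) (simp add: lookup_single when_def)

lemma smul_sum: "smul c (\<Sum>i\<in>I. f i) = (\<Sum>i\<in>I. smul c (f i))"
  by (induction I rule: infinite_finite_induct) (auto simp: smul_add)

definition lmap :: "(('a \<Rightarrow>\<^sub>0 'k::field) \<Rightarrow> ('b \<Rightarrow>\<^sub>0 'k)) \<Rightarrow> bool" where
  "lmap F \<longleftrightarrow> (\<forall>p q. F (p + q) = F p + F q) \<and> (\<forall>c p. F (smul c p) = smul c (F p))"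

lemma lmap_add: "lmap F \<Longrightarrow> F (p + q) = F p + F q"
  by (simp add: lmap_def)

lemma lmap_smul: "lmap F \<Longrightarrow> F (smul c p) = smul c (F p)"
  by (simp add: lmap_def)

lemma lmap_zero: "lmap F \<Longrightarrow> F 0 = 0"
  using lmap_smul[of F 0 0] by simp

lemma lmap_diff: "lmap F \<Longrightarrow> F (p - q) = F p - F q"
  using lmap_add[of F p "smul (- 1) q"] lmap_smul[of F "- 1" q]
  by (simp add: smul_minus_one)

lemma lmap_sum: "lmap F \<Longrightarrow> F (\<Sum>i\<in>I. f i) = (\<Sum>i\<in>I. F (f i))"
  by (induction I rule: infinite_finite_induct) (auto simp: lmap_add lmap_zero)

lemma lmap_compose: "lmap F \<Longrightarrow> lmap G \<Longrightarrow> lmap (\<lambda>p. F (G p))"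
  by (simp add: lmap_def)

lemma lmap_plus: "lmap F \<Longrightarrow> lmap G \<Longrightarrow> lmap (\<lambda>p. F p + G p)"
  by (simp add: lmap_def smul_add)

lemma lmap_minus: "lmap F \<Longrightarrow> lmap G \<Longrightarrow> lmap (\<lambda>p. F p - G p)"
  by (simp add: lmap_def smul_diff)

lemma lmap_id: "lmap (\<lambda>p. p)"
  by (simp add: lmap_def)

definition lin :: "('a \<Rightarrow> ('b \<Rightarrow>\<^sub>0 'k::field)) \<Rightarrow> ('a \<Rightarrow>\<^sub>0 'k) \<Rightarrow> ('b \<Rightarrow>\<^sub>0 'k)" where
  "lin f p = (\<Sum>a\<in>Poly_Mapping.keys p. smul (Poly_Mapping.lookup p a) (f a))"

text \<open>Cancellation can shrink the support of a sum, so additivity of \<open>lin\<close> is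
  proved by taking all sums over one common finite index set.\<close>

lemma lin_superset:
  assumes "finite A" "Poly_Mapping.keys p \<subseteq> A"
  shows "lin f p = (\<Sum>a\<in>A. smul (Poly_Mapping.lookup p a) (f a))"
  unfolding lin_def using assms
  by (intro sum.mono_neutral_left) (auto simp: in_keys_iff)

lemma lmap_lin: "lmap (lin f)"
proof -
  have "lin f (p + q) = lin f p + lin f q" for p q
    using lin_superset[of "Poly_Mapping.keys p \<union> Poly_Mapping.keys q" p f]
      lin_superset[of "Poly_Mapping.keys p \<union> Poly_Mapping.keys q" q f]
      lin_superset[of "Poly_Mapping.keys p \<union> Poly_Mapping.keys q" "p + q" f]
      Poly_Mapping.keys_add[of p q]
    by (simp add: lookup_add smul_add_left sum.distrib)
  moreover have "lin f (smul c p) = smul c (lin f p)" for c p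
  proof -
    have "Poly_Mapping.keys (smul c p) \<subseteq> Poly_Mapping.keys p"
      by (auto simp: in_keys_iff)
    then show ?thesis
      using lin_superset[of "Poly_Mapping.keys p" "smul c p" f]
      by (simp add: lin_def smul_sum smul_smul)
  qed
  ultimately show ?thesis
    by (simp add: lmap_def)
qed

lemma lin_single [simp]: "lin f (Poly_Mapping.single a 1) = f a"
  by (simp add: lin_def)

lemma lmap_lin_comp: "lmap F \<Longrightarrow> F (lin f p) = lin (\<lambda>a. F (f a)) p"
  by (simp add: lin_def lmap_sum lmap_smul)

lemma lin_id: "lin (\<lambda>a. Poly_Mapping.single a 1) p = p"
proof (rule poly_mapping_eqI)
  fix a
  have "Poly_Mapping.lookup (lin (\<lambda>a. Poly_Mapping.single a 1) p) a
      = (\<Sum>b\<in>Poly_Mapping.keys p. if b = a then Poly_Mapping.lookup p b else 0)"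
    by (simp add: lin_def smul_single Poly_Mapping.lookup_sum lookup_single when_def)
  then show "Poly_Mapping.lookup (lin (\<lambda>a. Poly_Mapping.single a 1) p) a = Poly_Mapping.lookup p a"
    by (auto simp: in_keys_iff)
qed

text \<open>Reduces the identities between products of combinations below to a single tree in one
  argument.\<close>

lemma lmap_eqI:
  assumes "lmap F" "lmap G" "\<And>a. F (Poly_Mapping.single a 1) = G (Poly_Mapping.single a 1)"
  shows "F p = G p"
  using lmap_lin_comp[OF assms(1), of "\<lambda>a. Poly_Mapping.single a 1" p]
    lmap_lin_comp[OF assms(2), of "\<lambda>a. Poly_Mapping.single a 1" p] assms(3)
  by (simp add: lin_id)

lemma lmap_lin_param: "(\<And>a. lmap (\<lambda>p. f a p)) \<Longrightarrow> lmap (\<lambda>p. lin (\<lambda>a. f a p) q)"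
  by (simp add: lmap_def lin_def smul_add smul_sum smul_smul mult.commute sum.distrib)

text \<open>The pushforward along \<open>h\<close>: labels that collide add their coefficients. It
  serves both for the tree constructors and for multiplication by a fixed word.\<close>

definition relabel :: "('a \<Rightarrow> 'b) \<Rightarrow> ('a \<Rightarrow>\<^sub>0 'k::field) \<Rightarrow> ('b \<Rightarrow>\<^sub>0 'k)" where
  "relabel h = lin (\<lambda>a. Poly_Mapping.single (h a) 1)"

lemma lmap_relabel: "lmap (relabel h)"
  by (simp add: relabel_def lmap_lin)

lemma relabel_single [simp]: "relabel h (Poly_Mapping.single a 1) = Poly_Mapping.single (h a) 1"
  by (simp add: relabel_def)

section \<open>The free dendriform algebra\<close>

text \<open>The four constructors stand for the irreducible words \<open>x\<close>, \<open>x \<prec> b\<close>, \<open>x \<succ> b\<close> and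
  \<open>(x \<succ> c) \<succ> b\<close>.\<close>

datatype 'x dtree = TGen 'x | TPrec 'x "'x dtree" | TSucc 'x "'x dtree" | TBoth 'x "'x dtree" "'x dtree"

text \<open>Needed because in the last clause of \<open>tsucc\<close> the product of
  \<open>c\<close> and \<open>b\<close> fills the inner slot of \<open>TBoth\<close>, and this
  product is a combination rather than a single tree.\<close>

definition graft :: "'x \<Rightarrow> ('x dtree \<Rightarrow>\<^sub>0 'k::field) \<Rightarrow> ('x dtree \<Rightarrow>\<^sub>0 'k) \<Rightarrow> ('x dtree \<Rightarrow>\<^sub>0 'k)" where
  "graft x p q = lin (\<lambda>c. relabel (TBoth x c) q) p"

text \<open>The equations are forced by the dendriform axioms. For instance \<open>f\<^sub>2\<close> gives
  \<open>(a \<succ> b) \<succ> z = a \<succ> (b \<succ> z) - (a \<prec> b) \<succ> z\<close>, where \<open>a \<prec> b = x \<succ> (c \<prec> b)\<close> if \<open>a = x \<succ> c\<close>.\<close>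

fun tprec tsucc :: "'x dtree \<Rightarrow> ('x dtree \<Rightarrow>\<^sub>0 'k::field) \<Rightarrow> ('x dtree \<Rightarrow>\<^sub>0 'k)" where
  "tprec (TGen x) z = relabel (TPrec x) z"
| "tprec (TPrec x b) z = relabel (TPrec x) (tprec b z + tsucc b z)"
| "tprec (TSucc x b) z = relabel (TSucc x) (tprec b z)"
| "tprec (TBoth x c b) z = relabel (TBoth x c) (tprec b z)"
| "tsucc (TGen x) z = relabel (TSucc x) z"
| "tsucc (TPrec x b) z = relabel (TSucc x) (tsucc b z) - relabel (TBoth x b) z"
| "tsucc (TSucc x b) z = relabel (TBoth x b) z"
| "tsucc (TBoth x c b) z =
     relabel (TBoth x c) (tsucc b z) - graft x (tprec c (Poly_Mapping.single b 1)) z"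

definition dprec (infixl "\<lhd>" 70) where "p \<lhd> q = lin (\<lambda>t. tprec t q) p"
definition dsucc (infixl "\<rhd>" 70) where "p \<rhd> q = lin (\<lambda>t. tsucc t q) p"

lemma lmap_graft_left: "lmap (\<lambda>p. graft x p q)"
  by (simp add: graft_def lmap_lin)

lemma lmap_graft_right: "lmap (\<lambda>q. graft x p q)"
  unfolding graft_def by (intro lmap_lin_param lmap_relabel)

lemma lmap_tprec_tsucc:
  "lmap (tprec t :: ('x dtree \<Rightarrow>\<^sub>0 'k::field) \<Rightarrow> _)" "lmap (tsucc t :: ('x dtree \<Rightarrow>\<^sub>0 'k) \<Rightarrow> _)"
  by (induction t)
     (auto simp: lmap_def smul_add smul_diff lmap_add[OF lmap_relabel] lmap_smul[OF lmap_relabel]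
       lmap_add[OF lmap_graft_right] lmap_smul[OF lmap_graft_right]
       algebra_simps)

lemma lmap_dprec_left: "lmap (\<lambda>p. p \<lhd> q)"
  by (simp add: dprec_def lmap_lin)

lemma lmap_dsucc_left: "lmap (\<lambda>p. p \<rhd> q)"
  by (simp add: dsucc_def lmap_lin)

lemma lmap_dprec_right: "lmap (\<lambda>q. p \<lhd> q)"
  unfolding dprec_def by (intro lmap_lin_param lmap_tprec_tsucc)

lemma lmap_dsucc_right: "lmap (\<lambda>q. p \<rhd> q)"
  unfolding dsucc_def by (intro lmap_lin_param lmap_tprec_tsucc)

lemmas d_linear =
  lmap_add[OF lmap_dprec_left] lmap_diff[OF lmap_dprec_left]
  lmap_add[OF lmap_dsucc_left] lmap_diff[OF lmap_dsucc_left]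
  lmap_add[OF lmap_dprec_right] lmap_diff[OF lmap_dprec_right]
  lmap_add[OF lmap_dsucc_right] lmap_diff[OF lmap_dsucc_right]
  lmap_add[OF lmap_graft_left] lmap_diff[OF lmap_graft_left]
  lmap_add[OF lmap_graft_right] lmap_diff[OF lmap_graft_right]
  lmap_add[OF lmap_relabel] lmap_diff[OF lmap_relabel]

lemma single_dprec [simp]: "Poly_Mapping.single t 1 \<lhd> w = tprec t w"
  by (simp add: dprec_def)

lemma single_dsucc [simp]: "Poly_Mapping.single t 1 \<rhd> w = tsucc t w"
  by (simp add: dsucc_def)

lemma graft_single [simp]: "graft x (Poly_Mapping.single c 1) q = relabel (TBoth x c) q"
  by (simp add: graft_def)

lemmas lmap_intros = lmap_compose[OF lmap_relabel] lmap_compose[OF lmap_dprec_left]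
  lmap_compose[OF lmap_dsucc_left] lmap_compose[OF lmap_graft_left]
  lmap_compose[OF lmap_graft_right] lmap_plus lmap_minus
  lmap_relabel lmap_dprec_left lmap_dsucc_left lmap_graft_left lmap_graft_right
  lmap_dprec_right lmap_dsucc_right

text \<open>The equations from here to \<open>graft_dsucc\<close> lift the clauses of
  \<open>tprec\<close> and \<open>tsucc\<close> from a tree to a combination in the place of a
  subtree, the form in which the proof of the dendriform axioms meets them.\<close>

lemma relabel_TPrec_dprec: "relabel (TPrec x) z \<lhd> w = relabel (TPrec x) (z \<lhd> w + z \<rhd> w)"
  by (rule lmap_eqI[of _ _ z]) (auto intro!: lmap_intros)

lemma relabel_TSucc_dprec: "relabel (TSucc x) z \<lhd> w = relabel (TSucc x) (z \<lhd> w)"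
  by (rule lmap_eqI[of _ _ z]) (auto intro!: lmap_intros)

lemma relabel_TBoth_dprec: "relabel (TBoth x c) z \<lhd> w = relabel (TBoth x c) (z \<lhd> w)"
  by (rule lmap_eqI[of _ _ z]) (auto intro!: lmap_intros)

lemma graft_dprec: "graft x p z \<lhd> w = graft x p (z \<lhd> w)"
  by (rule lmap_eqI[of _ _ p]) (auto intro!: lmap_intros simp: relabel_TBoth_dprec)

lemma relabel_TPrec_dsucc: "relabel (TPrec x) z \<rhd> w = relabel (TSucc x) (z \<rhd> w) - graft x z w"
  by (rule lmap_eqI[of _ _ z]) (auto intro!: lmap_intros)

lemma relabel_TSucc_dsucc: "relabel (TSucc x) z \<rhd> w = graft x z w"
  by (rule lmap_eqI[of _ _ z]) (auto intro!: lmap_intros)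

lemma relabel_TBoth_dsucc:
  "relabel (TBoth x c) z \<rhd> w = relabel (TBoth x c) (z \<rhd> w) - graft x (tprec c z) w"
  by (rule lmap_eqI[of _ _ z])
     (auto intro!: lmap_intros lmap_compose[OF lmap_graft_left] lmap_tprec_tsucc)

lemma graft_dsucc: "graft x p z \<rhd> w = graft x p (z \<rhd> w) - graft x (p \<lhd> z) w"
  by (rule lmap_eqI[of _ _ p]) (auto intro!: lmap_intros simp: relabel_TBoth_dsucc)

text \<open>The three axioms are interlocked and go by one induction on the left factor: the first
  for \<open>TPrec x b\<close> uses all three for \<open>b\<close>, and the third for
  \<open>TBoth x c b\<close> uses the first for \<open>c\<close>.\<close>

lemma dendriform_tree:
  fixes v w :: "'x dtree \<Rightarrow>\<^sub>0 'k::field"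
  shows "tprec t v \<lhd> w = tprec t (v \<lhd> w + v \<rhd> w)"
    and "tsucc t v \<lhd> w = tsucc t (v \<lhd> w)"
    and "tprec t v \<rhd> w + tsucc t v \<rhd> w = tsucc t (v \<rhd> w)"
proof (induction t arbitrary: v w)
  case (TGen x)
  {
    case 1 then show ?case by (simp add: relabel_TPrec_dprec)
  next
    case 2 then show ?case by (simp add: relabel_TSucc_dprec)
  next
    case 3 then show ?case by (simp add: relabel_TPrec_dsucc relabel_TSucc_dsucc)
  }
next
  case (TPrec x b)
  note lin_b = lmap_add[OF lmap_tprec_tsucc(1)[of b]] lmap_add[OF lmap_tprec_tsucc(2)[of b]]
  {
    case 1
    show ?case
      using TPrec.IH(1,2)[of v w]
      by (simp add: relabel_TPrec_dprec d_linear lin_b algebra_simps flip: TPrec.IH(3)[of v w])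
  next
    case 2
    show ?case
      using TPrec.IH[of v w] by (simp add: relabel_TSucc_dprec relabel_TBoth_dprec d_linear)
  next
    case 3
    have "tsucc b (v \<rhd> w) = tprec b v \<rhd> w + tsucc b v \<rhd> w"
      using TPrec.IH(3)[of v w] by simp
    then show ?case
      by (simp add: relabel_TPrec_dsucc relabel_TSucc_dsucc relabel_TBoth_dsucc d_linear algebra_simps)
  }
next
  case (TSucc x b)
  {
    case 1 show ?case using TSucc.IH[of v w] by (simp add: relabel_TSucc_dprec d_linear)
  next
    case 2 show ?case by (simp add: relabel_TBoth_dprec)
  next
    case 3 show ?case by (simp add: relabel_TSucc_dsucc relabel_TBoth_dsucc)
  }
next
  case (TBoth x c b)
  {
    case 1 show ?case using TBoth.IH[of v w] by (simp add: relabel_TBoth_dprec d_linear)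
  next
    case 2 show ?case
      using TBoth.IH[of v w] by (simp add: relabel_TBoth_dprec graft_dprec d_linear)
  next
    case 3
    have b: "tsucc b (v \<rhd> w) = tprec b v \<rhd> w + tsucc b v \<rhd> w"
      using TBoth.IH(6)[of v w] by simp
    \<comment> \<open>The correction terms from \<open>tsucc\<close> cancel by the first axiom for
      \<open>c\<close>, taken with the tree \<open>b\<close> in the middle.\<close>
    have c: "tprec c (Poly_Mapping.single b 1) \<lhd> v = tprec c (tprec b v) + tprec c (tsucc b v)"
      using TBoth.IH(1)[of "Poly_Mapping.single b 1" v] lmap_add[OF lmap_tprec_tsucc(1)[of c]] by simp
    show ?case
      by (simp add: relabel_TBoth_dsucc graft_dsucc d_linear b c algebra_simps)
  }
qed

lemma dprec_dprec: "(u \<lhd> v) \<lhd> w = u \<lhd> (v \<lhd> w + v \<rhd> w)"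
  by (rule lmap_eqI[of _ _ u]) (auto intro!: lmap_intros simp: dendriform_tree)

lemma dsucc_dprec: "(u \<rhd> v) \<lhd> w = u \<rhd> (v \<lhd> w)"
  by (rule lmap_eqI[of _ _ u]) (auto intro!: lmap_intros simp: dendriform_tree)

lemma dsucc_dsucc: "(u \<lhd> v) \<rhd> w + (u \<rhd> v) \<rhd> w = u \<rhd> (v \<rhd> w)"
  by (rule lmap_eqI[of _ _ u]) (auto intro!: lmap_intros simp: dendriform_tree)

section \<open>Normal forms\<close>

lemma bilinear_ext_lin: "bilinear_ext b f g = lin (\<lambda>u. lin (\<lambda>v. base (b u v)) g) f"
  by (simp add: bilinear_ext_def lin_def base_def smul_sum smul_single)

lemma lmap_lsucc_right: "lmap (\<lambda>g. f \<succ> g)"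
  unfolding lsucc_def bilinear_ext_lin by (intro lmap_lin_param lmap_lin)

lemma lsucc_base_base [simp]: "base u \<succ> base v = base (WSucc u v)"
  by (simp add: lsucc_def bilinear_ext_lin) (simp add: base_def)

lemma lprec_base_base [simp]: "base u \<prec> base v = base (bracket_prec u v)"
  by (simp add: lprec_def bilinear_ext_lin) (simp add: base_def)

primrec nfw :: "'x lword \<Rightarrow> ('x dtree \<Rightarrow>\<^sub>0 'k::field)" where
  "nfw (Gen x) = Poly_Mapping.single (TGen x) 1"
| "nfw (WSucc u v) = nfw u \<rhd> nfw v"
| "nfw (WPrec u v) = nfw u \<lhd> nfw v"

definition nf :: "('x lword \<Rightarrow>\<^sub>0 'k::field) \<Rightarrow> ('x dtree \<Rightarrow>\<^sub>0 'k)" where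
  "nf = lin nfw"

lemma nf_lin: "nf f = lin nfw f"
  by (simp add: nf_def)

lemma lmap_nf: "lmap nf"
  by (simp add: nf_def lmap_lin)

lemma nf_base [simp]: "nf (base u) = nfw u"
  by (simp add: nf_def base_def)

text \<open>The bracket moves \<open>v\<close> past a left factor \<open>u1 \<succ> u2\<close> by
  the L-algebra identity, which the trees satisfy as \<open>dsucc_dprec\<close>.\<close>

lemma nfw_bracket_prec: "nfw (bracket_prec u v) = nfw u \<lhd> nfw v"
  by (induction u v rule: bracket_prec.induct) (simp_all add: dsucc_dprec)

lemma nf_bilinear_ext:
  assumes "\<And>u v. nfw (b u v) = m (nfw u) (nfw v)" "\<And>q. lmap (\<lambda>p. m p q)" "\<And>p. lmap (m p)"
  shows "nf (bilinear_ext b f g) = m (nf f) (nf g)"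
proof -
  have "nf (bilinear_ext b f g) = lin (\<lambda>u. lin (\<lambda>v. m (nfw u) (nfw v)) g) f"
    by (simp add: bilinear_ext_lin lmap_lin_comp[OF lmap_nf] assms(1))
  also have "\<dots> = lin (\<lambda>u. m (nfw u) (nf g)) f"
    by (simp add: nf_lin lmap_lin_comp[OF assms(3)])
  also have "\<dots> = m (nf f) (nf g)"
    by (simp add: nf_lin[of f] lmap_lin_comp[OF assms(2)])
  finally show ?thesis .
qed

lemma nf_lsucc: "nf (f \<succ> g) = nf f \<rhd> nf g"
  unfolding lsucc_def by (intro nf_bilinear_ext lmap_intros) simp

lemma nf_lprec: "nf (f \<prec> g) = nf f \<lhd> nf g"
  unfolding lprec_def by (intro nf_bilinear_ext lmap_intros) (simp add: nfw_bracket_prec)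

lemmas nf_simps = nf_lsucc nf_lprec lmap_add[OF lmap_nf] lmap_diff[OF lmap_nf]

lemma nf_f1: "nf (f1 x y z) = 0"
  by (simp add: f1_def nf_simps dprec_dprec d_linear flip: lsucc_base_base lprec_base_base)

lemma nf_f2: "nf (f2 x y z) = 0"
  by (simp add: f2_def nf_simps dsucc_dsucc flip: lsucc_base_base lprec_base_base)

text \<open>Since \<open>[(x \<succ> y) \<prec> z]\<close> is
  \<open>x \<succ> [y \<prec> z]\<close>, the third family is the part of the second whose first
  argument is a \<open>\<succ>\<close>-word; there a different term leads.\<close>

lemma f2_WSucc: "f2 (WSucc x y) z v = f3 x y z v"
  by (simp add: f2_def f3_def)

lemma nf_f3: "nf (f3 x y z v) = 0"
  by (simp add: nf_f2 flip: f2_WSucc)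

text \<open>A star puts a factor with zero normal form into the product, and the kernel of
  \<open>nf\<close> is an ideal.\<close>

lemma nf_subst_elt:
  assumes "nf s = 0" "star_count u \<noteq> 0"
  shows "nf (subst_elt u s) = 0"
  using assms(2)
  by (induction u)
     (auto simp: assms(1) nf_simps lmap_zero[OF lmap_dprec_left] lmap_zero[OF lmap_dprec_right]
       lmap_zero[OF lmap_dsucc_left] lmap_zero[OF lmap_dsucc_right] split: if_splits)

primrec word :: "'x dtree \<Rightarrow> 'x lword" where
  "word (TGen x) = Gen x"
| "word (TPrec x b) = WPrec (Gen x) (word b)"
| "word (TSucc x b) = WSucc (Gen x) (word b)"
| "word (TBoth x c b) = WSucc (WSucc (Gen x) (word c)) (word b)"

text \<open>Thus \<open>word\<close> is a section of \<open>nfw\<close>; this settles the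
  irreducible words in the reduction.\<close>

lemma nfw_word [simp]: "nfw (word t) = Poly_Mapping.single t 1"
  by (induction t) auto


section \<open>Leading words\<close>

text \<open>Joins the leading word with leading coefficient 1 and avoids \<open>Max\<close>, so that
  sums and relabelled elements can be treated by bounds on their supports.\<close>

definition has_lead :: "('x::linorder lword \<Rightarrow>\<^sub>0 'k::field) \<Rightarrow> 'x lword \<Rightarrow> bool" where
  "has_lead f w \<longleftrightarrow> Poly_Mapping.lookup f w = 1 \<and> (\<forall>v\<in>Poly_Mapping.keys f. v \<le> w)"

lemma has_lead_lead:
  assumes "has_lead f w"
  shows "lead f = w"
proof -
  have "w \<in> Poly_Mapping.keys f"
    using assms by (simp add: has_lead_def in_keys_iff)
  then show ?thesis
    using assms by (auto simp: has_lead_def lead_def intro!: Max_eqI)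
qed

lemma has_lead_monic: "has_lead f w \<Longrightarrow> monic f"
  using has_lead_lead[of f w] by (auto simp: monic_def has_lead_def)

lemma has_lead_base: "has_lead (base w) w"
  by (auto simp: has_lead_def base_def)

lemma has_lead_add:
  assumes "has_lead f w" "\<forall>v\<in>Poly_Mapping.keys g. v < w"
  shows "has_lead (f + g) w"
proof -
  have "w \<notin> Poly_Mapping.keys g"
    using assms(2) by blast
  then have "Poly_Mapping.lookup (f + g) w = 1"
    using assms(1) by (simp add: has_lead_def lookup_add in_keys_iff)
  moreover have "v \<le> w" if "v \<in> Poly_Mapping.keys (f + g)" for v
  proof -
    have "v \<in> Poly_Mapping.keys f \<or> v \<in> Poly_Mapping.keys g"
      using that Poly_Mapping.keys_add[of f g] by blast
    then show ?thesis
      using assms by (auto simp: has_lead_def less_imp_le)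
  qed
  ultimately show ?thesis
    by (simp add: has_lead_def)
qed

lemma has_lead_diff:
  assumes "has_lead f w" "\<forall>v\<in>Poly_Mapping.keys g. v < w"
  shows "has_lead (f - g) w"
  using has_lead_add[of f w "- g"] assms by simp

text \<open>The leading terms cancel. This gives both the descent in the reduction and the strict
  bound for inclusions.\<close>

lemma has_lead_diff_keys:
  assumes "has_lead f w" "has_lead g w" "v \<in> Poly_Mapping.keys (f - g)"
  shows "v < w"
proof -
  have "v \<noteq> w"
    using assms by (auto simp: has_lead_def in_keys_iff lookup_minus)
  moreover have "v \<in> Poly_Mapping.keys f \<union> Poly_Mapping.keys g"
    using assms(3) by (auto simp: in_keys_iff lookup_minus)
  ultimately show ?thesis
    using assms by (auto simp: has_lead_def)
qed

lemma keys_base [simp]: "Poly_Mapping.keys (base w :: _ \<Rightarrow>\<^sub>0 'k::field) = {w}"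
  by (simp add: base_def)

section \<open>Leading words under relabelling and multiplication\<close>

lemma lookup_relabel:
  "Poly_Mapping.lookup (relabel h f) v
     = (\<Sum>u\<in>Poly_Mapping.keys f. if h u = v then Poly_Mapping.lookup f u else 0)"
  by (auto simp: relabel_def lin_def smul_single Poly_Mapping.lookup_sum lookup_single when_def
      intro!: sum.cong)

lemma keys_relabel: "Poly_Mapping.keys (relabel h f) \<subseteq> h ` Poly_Mapping.keys f"
proof
  fix v assume "v \<in> Poly_Mapping.keys (relabel h f)"
  then have "(\<Sum>u\<in>Poly_Mapping.keys f. if h u = v then Poly_Mapping.lookup f u else 0) \<noteq> 0"
    by (simp add: in_keys_iff lookup_relabel)
  then obtain u where "u \<in> Poly_Mapping.keys f" "(if h u = v then Poly_Mapping.lookup f u else 0) \<noteq> 0"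
    by (rule sum.not_neutral_contains_not_neutral)
  then show "v \<in> h ` Poly_Mapping.keys f"
    by (auto split: if_splits)
qed

text \<open>No other word of \<open>f\<close> is sent to \<open>h w\<close>, so its coefficient
  survives; away from \<open>w\<close> the map \<open>h\<close> may identify words.\<close>

lemma has_lead_relabel:
  assumes f: "has_lead f w"
    and h: "\<And>u. u \<in> Poly_Mapping.keys f \<Longrightarrow> u < w \<Longrightarrow> h u < h w"
  shows "has_lead (relabel h f) (h w)"
proof -
  have w: "w \<in> Poly_Mapping.keys f" and le: "u \<le> w" if "u \<in> Poly_Mapping.keys f" for u
    using f that by (auto simp: has_lead_def in_keys_iff)
  have "Poly_Mapping.lookup (relabel h f) (h w)
      = (\<Sum>u\<in>Poly_Mapping.keys f. if u = w then Poly_Mapping.lookup f u else 0)"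
    unfolding lookup_relabel
  proof (intro sum.cong refl)
    fix u assume "u \<in> Poly_Mapping.keys f"
    then have "h u = h w \<longleftrightarrow> u = w"
      using h[of u] le[of u] by (auto simp: order.order_iff_strict)
    then show "(if h u = h w then Poly_Mapping.lookup f u else 0)
        = (if u = w then Poly_Mapping.lookup f u else 0)"
      by simp
  qed
  also have "\<dots> = 1"
    using f by (simp add: has_lead_def in_keys_iff)
  finally have "Poly_Mapping.lookup (relabel h f) (h w) = 1" .
  moreover have "v \<le> h w" if "v \<in> Poly_Mapping.keys (relabel h f)" for v
    using that keys_relabel[of h f] h le by (force simp: order.order_iff_strict)
  ultimately show ?thesis
    by (simp add: has_lead_def)
qed

lemma bilinear_ext_base_left: "bilinear_ext b (base u) g = relabel (b u) g"
  by (simp add: bilinear_ext_lin relabel_def) (simp add: base_def)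

lemma bilinear_ext_base_right: "bilinear_ext b f (base v) = relabel (\<lambda>u. b u v) f"
  by (simp add: bilinear_ext_lin relabel_def) (simp add: base_def)

lemma len_bracket_prec [simp]: "len (bracket_prec u v) = len u + len v"
  by (induction u v rule: bracket_prec.induct) auto

lemma len_neq_0 [simp]: "len u \<noteq> 0"
  using len_pos[of u] by linarith

lemma less_lword_if_shorter: "len u < len v \<Longrightarrow> u < v"
  by (cases u; cases v) auto

lemma bracket_prec_nonsucc: "\<nexists>u1 u2. u = WSucc u1 u2 \<Longrightarrow> bracket_prec u v = WPrec u v"
  by (cases u) auto

text \<open>If \<open>u\<close> is a \<open>\<succ>\<close>-word, so is its bracket with
  \<open>v\<close>; its length is at most that of the right side, and
  \<open>\<delta>\<^sub>1 < \<delta>\<^sub>2\<close> settles a tie.\<close>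

lemma bracket_prec_less:
  assumes "u < w" "\<nexists>w1 w2. w = WSucc w1 w2"
  shows "bracket_prec u v < WPrec w v"
  using less_lword_len[OF assms(1)] assms by (cases u) auto

lemma has_lead_lsucc_left: "has_lead f w \<Longrightarrow> has_lead (f \<succ> base v) (WSucc w v)"
  unfolding lsucc_def bilinear_ext_base_right
  by (rule has_lead_relabel) (auto dest: less_lword_len)

lemma has_lead_lsucc_right: "has_lead f w \<Longrightarrow> has_lead (base v \<succ> f) (WSucc v w)"
  unfolding lsucc_def bilinear_ext_base_left
  by (rule has_lead_relabel) (auto dest: less_lword_len)

lemma has_lead_lprec_left:
  assumes "has_lead f w" "\<nexists>w1 w2. w = WSucc w1 w2"
  shows "has_lead (f \<prec> base v) (WPrec w v)"
  using has_lead_relabel[OF assms(1), of "\<lambda>u. bracket_prec u v"] assms(2)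
  by (simp add: lprec_def bilinear_ext_base_right bracket_prec_nonsucc bracket_prec_less)

lemma has_lead_lprec_right:
  assumes "has_lead f w" "\<nexists>v1 v2. v = WSucc v1 v2"
  shows "has_lead (base v \<prec> f) (WPrec v w)"
proof -
  have "bracket_prec v u < bracket_prec v w" if "u < w" for u
    using assms(2) less_lword_len[OF that] that by (auto simp: bracket_prec_nonsucc)
  then show ?thesis
    using has_lead_relabel[OF assms(1), of "bracket_prec v"] assms(2)
    by (simp add: lprec_def bilinear_ext_base_left bracket_prec_nonsucc)
qed

lemma subst_elt_no_star:
  "star_count u = 0 \<Longrightarrow> normal (subst_word u t) \<Longrightarrow> subst_elt u s = base (subst_word u t)"
  by (induction u) (auto simp: bracket_prec_nonsucc split: if_splits)

text \<open>Induction along the path to the star. By normality every \<open>\<prec>\<close> on that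
  path has a left factor that is not a \<open>\<succ>\<close>-word, and such products preserve
  leading words.\<close>

lemma has_lead_subst_elt:
  assumes "has_lead s t"
  shows "star_count u = 1 \<Longrightarrow> normal (subst_word u t) \<Longrightarrow> has_lead (subst_elt u s) (subst_word u t)"
proof (induction u)
  case (Gen a)
  then show ?case using assms by (auto split: if_splits)
next
  case (WSucc u v)
  then consider "star_count u = 1" "star_count v = 0" | "star_count u = 0" "star_count v = 1"
    by (auto simp: add_is_1)
  then show ?case
    using WSucc
    by cases (auto simp: subst_elt_no_star[of _ t] intro: has_lead_lsucc_left has_lead_lsucc_right)
next
  case (WPrec u v)
  then consider "star_count u = 1" "star_count v = 0" | "star_count u = 0" "star_count v = 1"
    by (auto simp: add_is_1)
  then show ?case
    using WPrec
    by cases (auto simp: subst_elt_no_star[of _ t] intro: has_lead_lprec_left has_lead_lprec_right)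
qed

section \<open>Closure of the free L-algebra under its operations\<close>

lemma normal_bracket_prec: "normal u \<Longrightarrow> normal v \<Longrightarrow> normal (bracket_prec u v)"
  by (induction u v rule: bracket_prec.induct) auto

lemma free_L_add: "f \<in> free_L \<Longrightarrow> g \<in> free_L \<Longrightarrow> f + g \<in> free_L"
  using Poly_Mapping.keys_add[of f g] by (auto simp: free_L_def)

lemma free_L_zero: "0 \<in> free_L"
  by (simp add: free_L_def)

lemma free_L_diff: "f \<in> free_L \<Longrightarrow> g \<in> free_L \<Longrightarrow> f - g \<in> free_L"
  unfolding free_L_def using keys_diff[of f g] by blast

lemma free_L_base: "base u \<in> free_L \<longleftrightarrow> normal u"
  by (simp add: free_L_def normal_words_def)

lemma free_L_bilinear_ext:
  assumes "f \<in> free_L" "g \<in> free_L" "\<And>u v. normal u \<Longrightarrow> normal v \<Longrightarrow> normal (b u v)"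
  shows "bilinear_ext b f g \<in> free_L"
proof -
  have sum: "(\<And>i. i \<in> I \<Longrightarrow> F i \<in> free_L) \<Longrightarrow> sum F I \<in> free_L" for I and F :: "'a lword \<Rightarrow> _"
    by (induction I rule: infinite_finite_induct) (auto intro: free_L_add simp: free_L_zero)
  show ?thesis
    unfolding bilinear_ext_def using assms
    by (intro sum) (auto simp: free_L_def normal_words_def)
qed

lemma free_L_lsucc: "f \<in> free_L \<Longrightarrow> g \<in> free_L \<Longrightarrow> f \<succ> g \<in> free_L"
  unfolding lsucc_def by (rule free_L_bilinear_ext) auto

lemma free_L_lprec: "f \<in> free_L \<Longrightarrow> g \<in> free_L \<Longrightarrow> f \<prec> g \<in> free_L"
  unfolding lprec_def by (rule free_L_bilinear_ext) (auto simp: normal_bracket_prec)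

lemma free_L_subst_elt: "s \<in> free_L \<Longrightarrow> subst_elt u s \<in> free_L"
  by (induction u) (auto simp: free_L_lsucc free_L_lprec free_L_base split: option.split)

section \<open>The relations\<close>

text \<open>The L-algebra identity pulls \<open>p\<close> out of all three terms, so the leading
  word of \<open>f1\<close> is found by peeling off such factors.\<close>

lemma f1_WSucc: "f1 (WSucc p x) y z = base p \<succ> f1 x y z"
  by (simp add: f1_def lmap_diff[OF lmap_lsucc_right])

lemma has_lead_f1: "has_lead (f1 x y z) (bracket_prec (bracket_prec x y) z)"
proof (induction x)
  case (WSucc p x)
  then show ?case by (simp add: f1_WSucc has_lead_lsucc_right)
qed (auto simp: f1_def less_lword_if_shorter intro!: has_lead_diff has_lead_base)

lemma has_lead_f3: "has_lead (f3 x y z v) (WSucc (WSucc (WSucc x y) z) v)"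
  by (auto simp: f3_def less_lword_if_shorter intro!: has_lead_add has_lead_diff has_lead_base)

text \<open>The three terms are \<open>\<succ>\<close>-words of equal length, so their left factors
  decide: \<open>x \<prec> y\<close> exceeds \<open>x \<succ> y\<close> because
  \<open>\<delta>\<^sub>2 > \<delta>\<^sub>1\<close>, and exceeds \<open>x\<close> by
  length.\<close>

lemma has_lead_f2:
  assumes "\<nexists>x1 x2. x = WSucc x1 x2"
  shows "has_lead (f2 x y z) (WSucc (WPrec x y) z)"
  using assms
  by (auto simp: f2_def bracket_prec_nonsucc less_lword_if_shorter intro!: has_lead_add has_lead_diff has_lead_base)

lemma monic_f2: "monic (f2 x y z)"
  by (cases x)
     (auto simp: f2_WSucc intro: has_lead_monic[OF has_lead_f2] has_lead_monic[OF has_lead_f3])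

section \<open>Reduction to normal forms\<close>

lemma subst_word_lift [simp]: "subst_word (map_lword Some u) t = u" "star_count (map_lword Some u) = 0"
  by (induction u) auto

text \<open>A reducible factor passes its redex up through the context. If both factors are
  irreducible, the shape of the left one decides; it starts from a generator, so relations with a
  generator as first argument suffice for reduction.\<close>

lemma normal_word_cases:
  assumes "normal w"
  obtains (normal_form) t where "w = word t"
  | (f1) u x y z where "star_word u" "w = subst_word u (WPrec (WPrec (Gen x) y) z)"
      "normal y" "normal z"
  | (f2) u x y z where "star_word u" "w = subst_word u (WSucc (WPrec (Gen x) y) z)"
      "normal y" "normal z"
  | (f3) u x y z v where "star_word u" "w = subst_word u (WSucc (WSucc (WSucc (Gen x) y) z) v)"
      "normal y" "normal z" "normal v"
proof -
  define Red where "Red t \<longleftrightarrow> (\<exists>x y z. t = WPrec (WPrec (Gen x) y) z \<and> normal y \<and> normal z) \<or>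
    (\<exists>x y z. t = WSucc (WPrec (Gen x) y) z \<and> normal y \<and> normal z) \<or>
    (\<exists>x y z v. t = WSucc (WSucc (WSucc (Gen x) y) z) v \<and> normal y \<and> normal z \<and> normal v)"
    for t :: "'a lword"
  have red: "\<exists>u s. star_word u \<and> t = subst_word u s \<and> Red s" if "Red t" for t
    using that by (intro exI[of _ "Gen None"] exI[of _ t]) (simp add: star_word_def)
  have "(\<exists>t. w = word t) \<or> (\<exists>u s. star_word u \<and> w = subst_word u s \<and> Red s)"
    using assms
  proof (induction w)
    case (Gen x)
    have "Gen x = word (TGen x)" by simp
    then show ?case by blast
  next
    case (WSucc a b)
    then consider ta tb where "a = word ta" "b = word tb"
      | u s where "star_word u" "a = subst_word u s" "Red s"
      | u s where "star_word u" "b = subst_word u s" "Red s"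
      by auto
    then show ?case
    proof cases
      case 1
      show ?thesis
      proof (cases ta)
        case (TGen x)
        then have "WSucc a b = word (TSucc x tb)" using 1 by simp
        then show ?thesis by blast
      next
        case (TSucc x c)
        then have "WSucc a b = word (TBoth x c tb)" using 1 by simp
        then show ?thesis by blast
      next
        case (TPrec x c)
        then have "Red (WSucc a b)" using 1 WSucc.prems by (auto simp: Red_def)
        then show ?thesis using red by blast
      next
        case (TBoth x c d)
        then have "Red (WSucc a b)" using 1 WSucc.prems by (auto simp: Red_def)
        then show ?thesis using red by blast
      qed
    next
      case 2
      then have "star_word (WSucc u (map_lword Some b)) \<and>
        WSucc a b = subst_word (WSucc u (map_lword Some b)) s"
        by (simp add: star_word_def)
      then show ?thesis using 2 by blast
    next
      case 3
      then have "star_word (WSucc (map_lword Some a) u) \<and>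
        WSucc a b = subst_word (WSucc (map_lword Some a) u) s"
        by (simp add: star_word_def)
      then show ?thesis using 3 by blast
    qed
  next
    case (WPrec a b)
    then consider ta tb where "a = word ta" "b = word tb"
      | u s where "star_word u" "a = subst_word u s" "Red s"
      | u s where "star_word u" "b = subst_word u s" "Red s"
      by auto
    then show ?case
    proof cases
      case 1
      show ?thesis
      proof (cases ta)
        case (TGen x)
        then have "WPrec a b = word (TPrec x tb)" using 1 by simp
        then show ?thesis by blast
      next
        case (TPrec x c)
        then have "Red (WPrec a b)" using 1 WPrec.prems by (auto simp: Red_def)
        then show ?thesis using red by blast
      \<comment> \<open>For \<open>TSucc\<close> and \<open>TBoth\<close> the left factor is a
        \<open>\<succ>\<close>-word, against normality.\<close>
      qed (use 1 WPrec.prems in auto)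
    next
      case 2
      then have "star_word (WPrec u (map_lword Some b)) \<and>
        WPrec a b = subst_word (WPrec u (map_lword Some b)) s"
        by (simp add: star_word_def)
      then show ?thesis using 2 by blast
    next
      case 3
      then have "star_word (WPrec (map_lword Some a) u) \<and>
        WPrec a b = subst_word (WPrec (map_lword Some a) u) s"
        by (simp add: star_word_def)
      then show ?thesis using 3 by blast
    qed
  qed
  then show thesis
    using that unfolding Red_def by blast
qed

text \<open>Infinitely many words may share a length, so length alone is not enough. Within an
  induction on length, generators are accessible by the well-order on \<open>X\<close>, then
  \<open>\<succ>\<close>-words and finally \<open>\<prec>\<close>-words by nested induction on their
  two factors, as for a lexicographic product.\<close>

lemma wfp_less_lword: "wfp ((<) :: 'x::wellorder lword \<Rightarrow> 'x lword \<Rightarrow> bool)"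
proof -
  have "Wellfounded.accp (<) w" for w :: "'x lword"
  proof (induction "len w" arbitrary: w rule: less_induct)
    case less
    note shorter = less
    have gen: "Wellfounded.accp (<) (Gen x)" for x :: 'x
    proof (induction x rule: less_induct)
      case (less x)
      show ?case
      proof (rule accpI)
        fix v :: "'x lword" assume "v < Gen x"
        then show "Wellfounded.accp (<) v"
          using less by (cases v) auto
      qed
    qed
    have succ: "Wellfounded.accp (<) (WSucc a b)" if "len a + len b = len w" for a b :: "'x lword"
    proof -
      have "Wellfounded.accp (<) a"
        using that len_pos[of b] by (intro shorter) linarith
      then show ?thesis
        using that
      proof (induction arbitrary: b rule: accp.induct)
        case (accI a)
        note outer = accI.IH
        have "Wellfounded.accp (<) b"
          using accI.prems len_pos[of a] by (intro shorter) linarith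
        then show ?case
          using accI.prems
        proof (induction rule: accp.induct)
          case (accI b)
          show ?case
          proof (rule accpI)
            fix v assume "v < WSucc a b"
            then show "Wellfounded.accp (<) v"
              using outer accI.IH accI.prems shorter[of v] gen by (cases v) auto
          qed
        qed
      qed
    qed
    \<comment> \<open>Below such a word lie also all \<open>\<succ>\<close>-words of the same
      length, which \<open>succ\<close> covers.\<close>
    have prec: "Wellfounded.accp (<) (WPrec a b)" if "len a + len b = len w" for a b :: "'x lword"
    proof -
      have "Wellfounded.accp (<) a"
        using that len_pos[of b] by (intro shorter) linarith
      then show ?thesis
        using that
      proof (induction arbitrary: b rule: accp.induct)
        case (accI a)
        note outer = accI.IH
        have "Wellfounded.accp (<) b"
          using accI.prems len_pos[of a] by (intro shorter) linarith
        then show ?case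
          using accI.prems
        proof (induction rule: accp.induct)
          case (accI b)
          show ?case
          proof (rule accpI)
            fix v assume "v < WPrec a b"
            then show "Wellfounded.accp (<) v"
              using outer accI.IH accI.prems shorter[of v] gen succ by (cases v) (auto simp: le_less)
          qed
        qed
      qed
    qed
    show ?case
      using gen succ prec by (cases w) auto
  qed
  then show ?thesis
    by (intro accp_wfpI allI)
qed

section \<open>Closure properties of bounded combinations\<close>

lemma combination_bounded_zero: "combination_bounded S B 0"
  unfolding combination_bounded_def by (intro exI[of _ 0]) simp

lemma combination_bounded_mono:
  "combination_bounded S B h \<Longrightarrow> (\<And>t. B t \<Longrightarrow> B' t) \<Longrightarrow> combination_bounded S B' h"
  unfolding combination_bounded_def by blast

lemma combination_bounded_add_subst_elt:
  assumes "combination_bounded S B h" "s \<in> S" "normal_s_word u s" "B (subst_word u (lead s))"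
  shows "combination_bounded S B (h + smul c (subst_elt u s))"
proof -
  obtain n :: nat and \<alpha> us ss
    where "\<forall>i<n. ss i \<in> S \<and> normal_s_word (us i) (ss i) \<and> B (subst_word (us i) (lead (ss i)))"
    and "h = (\<Sum>i<n. scale (\<alpha> i) (subst_elt (us i) (ss i)))"
    using assms(1) unfolding combination_bounded_def by blast
  then show ?thesis
    unfolding combination_bounded_def using assms(2-)
    by (intro exI[of _ "Suc n"] exI[of _ "\<alpha>(n := c)"] exI[of _ "us(n := u)"] exI[of _ "ss(n := s)"])
       (auto simp: less_Suc_eq scale_eq_smul)
qed

lemma combination_bounded_smul:
  assumes "combination_bounded S B h"
  shows "combination_bounded S B (smul c h)"
proof -
  obtain n :: nat and \<alpha> us ss
    where "\<forall>i<n. ss i \<in> S \<and> normal_s_word (us i) (ss i) \<and> B (subst_word (us i) (lead (ss i)))"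
    and "h = (\<Sum>i<n. scale (\<alpha> i) (subst_elt (us i) (ss i)))"
    using assms unfolding combination_bounded_def by blast
  then show ?thesis
    unfolding combination_bounded_def
    by (intro exI[of _ n] exI[of _ "\<lambda>i. c * \<alpha> i"] exI[of _ us] exI[of _ ss])
       (auto simp: scale_eq_smul smul_sum smul_smul)
qed

lemma combination_bounded_add:
  assumes "combination_bounded S B g" "combination_bounded S B h"
  shows "combination_bounded S B (g + h)"
proof -
  obtain n :: nat and \<alpha> us ss
    where "\<forall>i<n. ss i \<in> S \<and> normal_s_word (us i) (ss i) \<and> B (subst_word (us i) (lead (ss i)))"
    and h: "h = (\<Sum>i<n. scale (\<alpha> i) (subst_elt (us i) (ss i)))"
    using assms(2) unfolding combination_bounded_def by blast
  then have "combination_bounded S B (g + (\<Sum>i<n. scale (\<alpha> i) (subst_elt (us i) (ss i))))"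
  proof (induction n arbitrary: h)
    case 0
    then show ?case using assms(1) by simp
  next
    case (Suc n)
    then have "combination_bounded S B ((g + (\<Sum>i<n. scale (\<alpha> i) (subst_elt (us i) (ss i))))
        + smul (\<alpha> n) (subst_elt (us n) (ss n)))"
      by (intro combination_bounded_add_subst_elt) auto
    then show ?case by (simp add: scale_eq_smul add.assoc)
  qed
  then show ?thesis by (simp add: h)
qed

lemma combination_bounded_sum:
  "(\<And>i. i \<in> I \<Longrightarrow> combination_bounded S B (f i)) \<Longrightarrow> combination_bounded S B (sum f I)"
  by (induction I rule: infinite_finite_induct)
     (auto intro: combination_bounded_zero combination_bounded_add)

definition of_nf :: "('x dtree \<Rightarrow>\<^sub>0 'k::field) \<Rightarrow> ('x lword \<Rightarrow>\<^sub>0 'k)" where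
  "of_nf = relabel word"

definition dendriform_relations :: "('x lword \<Rightarrow>\<^sub>0 'k::field) set" where
  "dendriform_relations =
     {f1 x y z | x y z. x \<in> normal_words \<and> y \<in> normal_words \<and> z \<in> normal_words} \<union>
     {f2 x y z | x y z. x \<in> normal_words \<and> y \<in> normal_words \<and> z \<in> normal_words} \<union>
     {f3 x y z v | x y z v. x \<in> normal_words \<and> y \<in> normal_words \<and> z \<in> normal_words \<and> v \<in> normal_words}"

lemma dendriform_relations_intros:
  "normal x \<Longrightarrow> normal y \<Longrightarrow> normal z \<Longrightarrow> f1 x y z \<in> dendriform_relations"
  "normal x \<Longrightarrow> normal y \<Longrightarrow> normal z \<Longrightarrow> f2 x y z \<in> dendriform_relations"
  "normal x \<Longrightarrow> normal y \<Longrightarrow> normal z \<Longrightarrow> normal v \<Longrightarrow> f3 x y z v \<in> dendriform_relations"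
  unfolding dendriform_relations_def normal_words_def by blast+

lemma dendriform_relations_props:
  assumes "f \<in> (dendriform_relations :: ('x::linorder lword \<Rightarrow>\<^sub>0 'k::field) set)"
  shows "f \<in> free_L" "monic f" "nf f = 0"
proof -
  show "f \<in> free_L"
    using assms
    by (auto simp: dendriform_relations_def f1_def f2_def f3_def normal_words_def free_L_base
        normal_bracket_prec intro!: free_L_add free_L_diff)
  show "monic f"
    using assms by (auto simp: dendriform_relations_def monic_f2
        intro: has_lead_monic[OF has_lead_f1] has_lead_monic[OF has_lead_f3])
  show "nf f = 0"
    using assms by (auto simp: dendriform_relations_def nf_f1 nf_f2 nf_f3)
qed

lemma reduce_lin:
  fixes h :: "'x::linorder lword \<Rightarrow>\<^sub>0 'k::field"
  assumes "\<And>w. w \<in> Poly_Mapping.keys h \<Longrightarrow> combination_bounded R B (base w - of_nf (nfw w))"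
  shows "combination_bounded R B (h - of_nf (nf h))"
proof -
  have lm: "lmap (\<lambda>h. h - of_nf (nf h :: _ \<Rightarrow>\<^sub>0 'k))"
    unfolding of_nf_def by (intro lmap_intros lmap_id lmap_nf)
  have "h - of_nf (nf h) = lin (\<lambda>w. base w - of_nf (nfw w)) h"
    using lmap_lin_comp[OF lm, of base h] by (simp add: base_def[abs_def] lin_id) (simp flip: base_def)
  then show ?thesis
    using assms by (auto simp: lin_def intro!: combination_bounded_sum combination_bounded_smul)
qed

text \<open>Well-founded induction on \<open>w\<close>: subtracting the normal \<open>s\<close>-word
  with leading word \<open>w\<close> leaves smaller words with the same normal form.\<close>

lemma reduce_word:
  fixes w :: "'x::wellorder lword"
  assumes "normal w"
  shows "combination_bounded (dendriform_relations :: ('x lword \<Rightarrow>\<^sub>0 'k::field) set) (\<lambda>t. t \<le> w)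
    (base w - of_nf (nfw w))"
  using wfp_less_lword assms
proof (induction w rule: wfp_induct_rule)
  case (less w)
  let ?R = "dendriform_relations :: ('x lword \<Rightarrow>\<^sub>0 'k::field) set"
  have reduce: ?case if s: "s \<in> ?R" "has_lead s t" and u: "star_word u" "w = subst_word u t" for s t u
  proof -
    let ?h = "base w - subst_elt u s"
    have lead: "has_lead (subst_elt u s) w"
      using has_lead_subst_elt[OF s(2), of u] u less.prems by (simp add: star_word_def)
    have "?h \<in> free_L"
      using less.prems dendriform_relations_props(1)[OF s(1)]
      by (intro free_L_diff free_L_subst_elt) (simp_all add: free_L_base)
    then have "combination_bounded ?R (\<lambda>t. t \<le> w) (?h - of_nf (nf ?h))"
      using has_lead_diff_keys[OF has_lead_base lead]
      by (intro reduce_lin combination_bounded_mono[OF less.IH])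
         (force simp: free_L_def normal_words_def)+
    \<comment> \<open>Adding the subtracted element back costs one summand whose leading word is
      \<open>w\<close> itself, hence the bound \<open>\<le>\<close>.\<close>
    then have "combination_bounded ?R (\<lambda>t. t \<le> w) (?h - of_nf (nf ?h) + smul 1 (subst_elt u s))"
      using s u less.prems
      by (intro combination_bounded_add_subst_elt)
         (auto simp: normal_s_word_def normal_words_def has_lead_lead)
    moreover have "nf ?h = nfw w"
      using nf_subst_elt[OF dendriform_relations_props(3)[OF s(1)], of u] u(1)
      by (simp add: lmap_diff[OF lmap_nf] star_word_def)
    ultimately show ?thesis by simp
  qed
  from less.prems show ?case
  proof (cases rule: normal_word_cases)
    case (normal_form t)
    then show ?thesis
      by (simp add: of_nf_def base_def combination_bounded_zero)
  next
    case (f1 u x y z)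
    have "has_lead (f1 (Gen x) y z) (WPrec (WPrec (Gen x) y) z)"
      using has_lead_f1[of "Gen x" y z] by simp
    from reduce[OF _ this f1(1,2)] f1(3,4) show ?thesis
      by (simp add: dendriform_relations_intros)
  next
    case (f2 u x y z)
    have "has_lead (f2 (Gen x) y z) (WSucc (WPrec (Gen x) y) z)"
      by (rule has_lead_f2) simp
    from reduce[OF _ this f2(1,2)] f2(3,4) show ?thesis
      by (simp add: dendriform_relations_intros)
  next
    case (f3 u x y z v)
    from reduce[OF _ has_lead_f3 f3(1,2)] f3(3-5) show ?thesis
      by (simp add: dendriform_relations_intros)
  qed
qed

text \<open>The residue of the reduction is the normal form, here zero. Both kinds of composition
  are settled by this criterion.\<close>

lemma combination_bounded_nf_zero:
  fixes h :: "'x::wellorder lword \<Rightarrow>\<^sub>0 'k::field"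
  assumes "h \<in> free_L" "nf h = 0" "\<And>v t. v \<in> Poly_Mapping.keys h \<Longrightarrow> t \<le> v \<Longrightarrow> B t"
  shows "combination_bounded dendriform_relations B h"
proof -
  have "combination_bounded dendriform_relations B (h - of_nf (nf h))"
    using assms(1,3)
    by (intro reduce_lin combination_bounded_mono[OF reduce_word])
       (auto simp: free_L_def normal_words_def)
  then show ?thesis
    by (simp add: assms(2) of_nf_def lmap_zero[OF lmap_relabel])
qed

theorem theorem3p2:
  shows "groebner_shirshov_basis
    ({f1 x y z | x y z. x \<in> normal_words \<and> y \<in> normal_words \<and> z \<in> normal_words} \<union>
     {f2 x y z | x y z. x \<in> normal_words \<and> y \<in> normal_words \<and> z \<in> normal_words} \<union>
     {f3 x y z v | x y z v. x \<in> normal_words \<and> y \<in> normal_words \<and> z \<in> normal_words \<and> v \<in> normal_words}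
     :: ('x::wellorder lword \<Rightarrow>\<^sub>0 'k::field) set)"
proof -
  let ?R = "dendriform_relations :: ('x lword \<Rightarrow>\<^sub>0 'k) set"
  \<comment> \<open>\<open>nf\<close> is multiplicative, so \<open>f \<prec> v\<close> stays in its
    kernel. The bound is asked only at words that occur, so the value of \<open>lead\<close> at 0
    does not matter.\<close>
  have "trivial_right_mult ?R f v" if "f \<in> ?R" "normal v" for f v
    unfolding trivial_right_mult_def using dendriform_relations_props[OF that(1)] that(2)
    by (intro combination_bounded_nf_zero)
       (auto simp: free_L_lprec free_L_base nf_lprec lmap_zero[OF lmap_dprec_left] lead_def
         intro: order.trans[OF _ Max_ge])
  moreover have "trivial_inclusion ?R (lead f) (f - subst_elt u g)"
    if "f \<in> ?R" "g \<in> ?R" "lead f = subst_word u (lead g)" "normal_s_word u g" for f g u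
  proof -
    have monic_lead: "has_lead f (lead f)" if "f \<in> ?R" for f
      using dendriform_relations_props(2)[OF that] by (auto simp: monic_def has_lead_def lead_def)
    have "has_lead (subst_elt u g) (lead f)"
      using has_lead_subst_elt[OF monic_lead[OF that(2)], of u] that(3,4)
      by (simp add: normal_s_word_def star_word_def normal_words_def)
    \<comment> \<open>Both elements have leading word \<open>w\<close> with coefficient 1, so only
      words below \<open>w\<close> remain and the bound is strict.\<close>
    from has_lead_diff_keys[OF monic_lead[OF that(1)] this] show ?thesis
      unfolding trivial_inclusion_def
      using dendriform_relations_props[OF that(1)] dendriform_relations_props[OF that(2)] that(4)
      by (intro combination_bounded_nf_zero)
         (auto simp: free_L_diff free_L_subst_elt nf_simps nf_subst_elt normal_s_word_def star_word_def
           intro: order.strict_trans1)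
  qed
  ultimately have "groebner_shirshov_basis ?R"
    using dendriform_relations_props
    by (auto simp: groebner_shirshov_basis_def normal_words_def)
  then show ?thesis
    by (simp add: dendriform_relations_def)
qed

end
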